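(* Let $J\ge1$, $(\bm\omega,s)\in\mathcal U$, $0<a_0\le1$ and $0<a_j<1$ for $1\le j\le J$. Let $\hat{\bm\rho}_j\in\mathbb C^6$, $0\le j\le J+1$, satisfy $$s\Lambda\hat{\bm\rho}_1-\widehat{\mathcal L}_0\hat{\bm\rho}_0=\bm0,\qquad\widehat{\mathcal L}_j\hat{\bm\rho}_j-\widehat{\mathcal K}_j\hat{\bm\rho}_{j+1}=\bm0\ (1\le j\le J),\qquad\hat{\bm\rho}_{J+1,-}=\bm0,$$ $$\hat{\bm\rho}_{1,\mathrm s}=\tfrac1s(\mathrm i\omega_2E_T-\mathrm i\omega_3J_T)\hat{\bm\rho}_{1,+}+\tfrac1s(\mathrm i\omega_2D_T-\mathrm i\omega_3I_T)\hat{\bm\rho}_{1,-}.$$ Then $$\hat{\bm\rho}_{0,-}=\hat S_\Gamma\,\hat{\bm\rho}_{0,+}\qquad\text{with}\qquad\hat S_\Gamma=\frac1{\beta_J}\hat M_{\bm\omega},\qquad\beta_J=\frac{(\kappa+s)^2-(\kappa-s)^2\gamma_J}{1-\gamma_J},$$ where $\gamma_J=\dfrac{\gamma_0^-}{\gamma_0^+}\prod_{j=1}^J\Big(\dfrac{\gamma_j^-}{\gamma_j^+}\Big)^2$ and $\gamma_j^\pm=a_js\pm\kappa$.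
   Context: $\mathcal U=\{(\bm\omega,s)\in\mathbb R^2\times\mathbb C:\operatorname{Re}s>0\}$, $\bm\omega=(\omega_2,\omega_3)$, $\kappa=\sqrt{s^2+|\bm\omega|^2}$ (principal branch), $\hat M_{\bm\omega}=\begin{pmatrix}\omega_2^2-\omega_3^2&2\omega_2\omega_3\\2\omega_2\omega_3&-(\omega_2^2-\omega_3^2)\end{pmatrix}$. Vectors in $\mathbb C^6$ are written $\hat{\bm\rho}=(\hat{\bm\rho}_+^\top,\hat{\bm\rho}_{\mathrm s}^\top,\hat{\bm\rho}_-^\top)^\top$ with three components in $\mathbb C^2$. $\Lambda=\operatorname{diag}(1,1,0,0,-1,-1)$ and $$\widehat{\mathcal L}_j=(a_j\Lambda-I_6)s-\mathrm i\omega_2\widetilde A_2-\mathrm i\omega_3\widetilde A_3,\qquad\widehat{\mathcal K}_j=(a_j\Lambda+I_6)s+\mathrm i\omega_2\widetilde A_2+\mathrm i\omega_3\widetilde A_3,$$ $$\widetilde A_2=\begin{pmatrix}0&-E_T&0\\-E_T&0&-D_T\\0&D_T&0\end{pmatrix},\qquad\widetilde A_3=\begin{pmatrix}0&J_T&0\\ J_T&0&I_T\\0&I_T&0\end{pmatrix},$$ with $E_T=\tfrac{\sqrt2}2\begin{pmatrix}0&1\\1&0\end{pmatrix}$, $D_T=\tfrac{\sqrt2}2\begin{pmatrix}0&1\\-1&0\end{pmatrix}$, $I_T=\tfrac{\sqrt2}2I_2$, $J_T=\tfrac{\sqrt2}2\begin{pmatrix}1&0\\0&-1\end{pmatrix}$.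 *)

theory Defs
  imports "HOL-Analysis.Analysis"
begin

text \<open>
  The library has no multiplication of a matrix by a scalar over a general ring
  (\<^const>\<open>scaleR\<close> only covers real scalars).
\<close>

definition smult_mat :: "complex \<Rightarrow> complex^'n^'m \<Rightarrow> complex^'n^'m"  (infixr "\<cdot>\<^sub>M" 75)
  where "c \<cdot>\<^sub>M A = (\<chi> i j. c * A $ i $ j)"

definition U_set :: "((real \<times> real) \<times> complex) set"
  where "U_set = {(\<omega>, s). Re s > 0}"

text \<open>\<^const>\<open>csqrt\<close> is the principal branch; the norm on pairs is the Euclidean one.\<close>

definition kappa :: "real \<times> real \<Rightarrow> complex \<Rightarrow> complex"
  where "kappa \<omega> s = csqrt (s\<^sup>2 + of_real ((norm \<omega>)\<^sup>2))"

definition M_hat :: "real \<times> real \<Rightarrow> complex^2^2"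
  where "M_hat \<omega> = (case \<omega> of (\<omega>\<^sub>2, \<omega>\<^sub>3) \<Rightarrow>
    vector [vector [of_real (\<omega>\<^sub>2\<^sup>2 - \<omega>\<^sub>3\<^sup>2), of_real (2 * \<omega>\<^sub>2 * \<omega>\<^sub>3)],
            vector [of_real (2 * \<omega>\<^sub>2 * \<omega>\<^sub>3), of_real (- (\<omega>\<^sub>2\<^sup>2 - \<omega>\<^sub>3\<^sup>2))]])"

definition stack :: "complex^2 \<Rightarrow> complex^2 \<Rightarrow> complex^2 \<Rightarrow> complex^6"
  where "stack u v w = vector [u $ 1, u $ 2, v $ 1, v $ 2, w $ 1, w $ 2]"

definition plus_part :: "complex^6 \<Rightarrow> complex^2"
  where "plus_part \<rho> = vector [\<rho> $ 1, \<rho> $ 2]"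

definition s_part :: "complex^6 \<Rightarrow> complex^2"
  where "s_part \<rho> = vector [\<rho> $ 3, \<rho> $ 4]"

definition minus_part :: "complex^6 \<Rightarrow> complex^2"
  where "minus_part \<rho> = vector [\<rho> $ 5, \<rho> $ 6]"

text \<open>
  In an expression \<open>A $ i $ j\<close> the row index comes first, so a \<open>6 \<times> 6\<close> matrix given by
  \<open>2 \<times> 2\<close> blocks is the vector of its six rows.
\<close>

definition block3 ::
  "complex^2^2 \<Rightarrow> complex^2^2 \<Rightarrow> complex^2^2 \<Rightarrow>
   complex^2^2 \<Rightarrow> complex^2^2 \<Rightarrow> complex^2^2 \<Rightarrow>
   complex^2^2 \<Rightarrow> complex^2^2 \<Rightarrow> complex^2^2 \<Rightarrow> complex^6^6"
  where "block3 A11 A12 A13 A21 A22 A23 A31 A32 A33 = vector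
    [stack (A11 $ 1) (A12 $ 1) (A13 $ 1), stack (A11 $ 2) (A12 $ 2) (A13 $ 2),
     stack (A21 $ 1) (A22 $ 1) (A23 $ 1), stack (A21 $ 2) (A22 $ 2) (A23 $ 2),
     stack (A31 $ 1) (A32 $ 1) (A33 $ 1), stack (A31 $ 2) (A32 $ 2) (A33 $ 2)]"

definition E_T :: "complex^2^2"
  where "E_T = of_real (sqrt 2 / 2) \<cdot>\<^sub>M vector [vector [0, 1], vector [1, 0]]"

definition D_T :: "complex^2^2"
  where "D_T = of_real (sqrt 2 / 2) \<cdot>\<^sub>M vector [vector [0, 1], vector [- 1, 0]]"

definition I_T :: "complex^2^2"
  where "I_T = of_real (sqrt 2 / 2) \<cdot>\<^sub>M mat 1"

definition J_T :: "complex^2^2"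
  where "J_T = of_real (sqrt 2 / 2) \<cdot>\<^sub>M vector [vector [1, 0], vector [0, - 1]]"

definition A2_tilde :: "complex^6^6"
  where "A2_tilde = block3
    0       (- E_T) 0
    (- E_T) 0       (- D_T)
    0       D_T     0"

definition A3_tilde :: "complex^6^6"
  where "A3_tilde = block3
    0   J_T 0
    J_T 0   I_T
    0   I_T 0"

definition Lambda_mat :: "complex^6^6"
  where "Lambda_mat = (\<chi> i j. if i = j then vector [1, 1, 0, 0, - 1, - 1] $ i else 0)"

text \<open>In the next two definitions the real parameter \<open>a\<close> stands for \<open>a\<^sub>j\<close>.\<close>

definition L_hat :: "real \<Rightarrow> real \<times> real \<Rightarrow> complex \<Rightarrow> complex^6^6"
  where "L_hat a \<omega> s = (case \<omega> of (\<omega>\<^sub>2, \<omega>\<^sub>3) \<Rightarrow>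
    s \<cdot>\<^sub>M (of_real a \<cdot>\<^sub>M Lambda_mat - mat 1)
      - (\<i> * of_real \<omega>\<^sub>2) \<cdot>\<^sub>M A2_tilde - (\<i> * of_real \<omega>\<^sub>3) \<cdot>\<^sub>M A3_tilde)"

definition K_hat :: "real \<Rightarrow> real \<times> real \<Rightarrow> complex \<Rightarrow> complex^6^6"
  where "K_hat a \<omega> s = (case \<omega> of (\<omega>\<^sub>2, \<omega>\<^sub>3) \<Rightarrow>
    s \<cdot>\<^sub>M (of_real a \<cdot>\<^sub>M Lambda_mat + mat 1)
      + (\<i> * of_real \<omega>\<^sub>2) \<cdot>\<^sub>M A2_tilde + (\<i> * of_real \<omega>\<^sub>3) \<cdot>\<^sub>M A3_tilde)"

definition gamma_plus :: "(nat \<Rightarrow> real) \<Rightarrow> real \<times> real \<Rightarrow> complex \<Rightarrow> nat \<Rightarrow> complex"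
  where "gamma_plus a \<omega> s j = of_real (a j) * s + kappa \<omega> s"

definition gamma_minus :: "(nat \<Rightarrow> real) \<Rightarrow> real \<times> real \<Rightarrow> complex \<Rightarrow> nat \<Rightarrow> complex"
  where "gamma_minus a \<omega> s j = of_real (a j) * s - kappa \<omega> s"

definition gamma_total :: "(nat \<Rightarrow> real) \<Rightarrow> real \<times> real \<Rightarrow> complex \<Rightarrow> nat \<Rightarrow> complex"
  where "gamma_total a \<omega> s J =
    gamma_minus a \<omega> s 0 / gamma_plus a \<omega> s 0
      * (\<Prod>j = 1..J. (gamma_minus a \<omega> s j / gamma_plus a \<omega> s j)\<^sup>2)"

definition beta :: "(nat \<Rightarrow> real) \<Rightarrow> real \<times> real \<Rightarrow> complex \<Rightarrow> nat \<Rightarrow> complex"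
  where "beta a \<omega> s J =
    ((kappa \<omega> s + s)\<^sup>2 - (kappa \<omega> s - s)\<^sup>2 * gamma_total a \<omega> s J)
      / (1 - gamma_total a \<omega> s J)"

definition S_Gamma :: "(nat \<Rightarrow> real) \<Rightarrow> real \<times> real \<Rightarrow> complex \<Rightarrow> nat \<Rightarrow> complex^2^2"
  where "S_Gamma a \<omega> s J = (1 / beta a \<omega> s J) \<cdot>\<^sub>M M_hat \<omega>"

end

theory Submission
  imports Defs
begin

text \<open>
  Write \<open>B = s I + \<i> \<omega>\<^sub>2 A\<^sub>2 + \<i> \<omega>\<^sub>3 A\<^sub>3\<close>, so that the two layer matrices are
  \<open>a s \<Lambda> - B\<close> and \<open>a s \<Lambda> + B\<close>. As the middle rows of \<open>\<Lambda>\<close> vanish, each layer equation says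
  in its middle rows that \<open>(B \<rho>\<^sub>j)\<^sub>s\<close> and \<open>(B \<rho>\<^sub>j\<^sub>+\<^sub>1)\<^sub>s\<close> are opposite. The relation imposed on
  the middle component of \<open>\<rho>\<^sub>1\<close> is exactly \<open>(B \<rho>\<^sub>1)\<^sub>s = 0\<close>, hence \<open>(B \<rho>\<^sub>j)\<^sub>s = 0\<close> in every
  layer, and the first equation gives this for \<open>\<rho>\<^sub>0\<close> too. The middle component can thus be
  eliminated everywhere.

  What remains of \<open>\<Lambda> B\<close> acts on the pair of outer components; its square is \<open>\<kappa>\<^sup>2\<close>, and the
  \<open>\<complex>\<^sup>2\<close>-valued forms \<open>mode k \<rho> = (s + k)\<^sup>2 \<rho>\<^sub>- - M \<rho>\<^sub>+\<close> with \<open>k = \<kappa>\<close> and \<open>k = - \<kappa>\<close> are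
  multiplied by \<open>- k\<close> when \<open>\<Lambda> B\<close> is applied to \<open>\<rho>\<close> (lemma \<open>mode_eigenform\<close>).
  A layer therefore acts on each form by a scalar,
  \<open>(a\<^sub>j s + k) mode k \<rho>\<^sub>j = (a\<^sub>j s - k) mode k \<rho>\<^sub>j\<^sub>+\<^sub>1\<close>: the quotient
  \<open>\<gamma>\<^sub>j\<^sup>- / \<gamma>\<^sub>j\<^sup>+\<close> carries the form for \<open>- \<kappa>\<close> from \<open>\<rho>\<^sub>j\<close> to \<open>\<rho>\<^sub>j\<^sub>+\<^sub>1\<close> and the form for \<open>\<kappa>\<close> back
  from \<open>\<rho>\<^sub>j\<^sub>+\<^sub>1\<close> to \<open>\<rho>\<^sub>j\<close>. At the outer end \<open>\<rho>\<^sub>- = 0\<close>, and the two forms coincide. Going out to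
  that end with \<open>- \<kappa>\<close> and returning with \<open>\<kappa>\<close> collects each quotient twice; the
  interface between \<open>\<rho>\<^sub>0\<close> and \<open>\<rho>\<^sub>1\<close> has a numerator on one way and a denominator on the other,
  hence contributes its quotient once. The outcome is
  \<open>mode \<kappa> \<rho>\<^sub>0 = \<gamma> mode (- \<kappa>) \<rho>\<^sub>0\<close>; solving it for \<open>\<rho>\<^sub>0\<^sub>,\<^sub>-\<close> gives the claim.

  The denominators do not vanish because \<open>Re (s \<kappa>\<^sup>*) > 0\<close> (lemma \<open>Re_s_cnj_kappa_pos\<close>, where
  the star is complex conjugation): for \<open>a > 0\<close> this makes \<open>\<bar>a s - \<kappa>\<bar> < \<bar>a s + \<kappa>\<bar>\<close>, whence
  \<open>\<bar>\<gamma>\<bar> < 1\<close>, and with \<open>a = 1\<close> it separates \<open>(\<kappa> + s)\<^sup>2\<close> from \<open>(\<kappa> - s)\<^sup>2 \<gamma>\<close>.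
\<close>

section \<open>Block calculus on six components\<close>

lemma exhaust_6: fixes x :: 6 shows "x = 1 \<or> x = 2 \<or> x = 3 \<or> x = 4 \<or> x = 5 \<or> x = 6"
proof (induct x)
  case (of_int z)
  then have "0 \<le> z" and "z < 6" by simp_all
  then have "z = 0 \<or> z = 1 \<or> z = 2 \<or> z = 3 \<or> z = 4 \<or> z = 5" by arith
  then show ?case by auto
qed

lemma UNIV_6: "(UNIV :: 6 set) = {1, 2, 3, 4, 5, 6}"
  using exhaust_6 by auto

lemma sum_6: "sum f (UNIV::6 set) = f 1 + f 2 + f 3 + f 4 + f 5 + f 6"
  unfolding UNIV_6 by (simp add: ac_simps)

lemma vector_6:
  "(vector [a, b, c, d, e, f] :: ('a::zero)^6) $ 1 = a"
  "(vector [a, b, c, d, e, f] :: ('a::zero)^6) $ 2 = b"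
  "(vector [a, b, c, d, e, f] :: ('a::zero)^6) $ 3 = c"
  "(vector [a, b, c, d, e, f] :: ('a::zero)^6) $ 4 = d"
  "(vector [a, b, c, d, e, f] :: ('a::zero)^6) $ 5 = e"
  "(vector [a, b, c, d, e, f] :: ('a::zero)^6) $ 6 = f"
  by (simp_all add: vector_def)

lemmas parts_defs = plus_part_def s_part_def minus_part_def

lemma parts_linear:
  "plus_part (x + y) = plus_part x + plus_part y" "plus_part (x - y) = plus_part x - plus_part y"
  "plus_part (c *s x) = c *s plus_part x"
  "s_part (x + y) = s_part x + s_part y" "s_part (x - y) = s_part x - s_part y"
  "s_part (c *s x) = c *s s_part x"
  "minus_part (x + y) = minus_part x + minus_part y" "minus_part (x - y) = minus_part x - minus_part y"
  "minus_part (c *s x) = c *s minus_part x"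
  by (simp_all add: parts_defs vec_eq_iff forall_2)

lemma parts_block3:
  fixes A11 A12 A13 A21 A22 A23 A31 A32 A33 :: "complex^2^2"
  defines "A \<equiv> block3 A11 A12 A13 A21 A22 A23 A31 A32 A33"
  shows "plus_part (A *v x) = A11 *v plus_part x + A12 *v s_part x + A13 *v minus_part x"
    "s_part (A *v x) = A21 *v plus_part x + A22 *v s_part x + A23 *v minus_part x"
    "minus_part (A *v x) = A31 *v plus_part x + A32 *v s_part x + A33 *v minus_part x"
  unfolding A_def
  by (simp_all add: parts_defs block3_def stack_def vec_eq_iff forall_2
    matrix_vector_mult_def sum_2 sum_6 vector_6)

lemma parts_Lambda:
  "plus_part (Lambda_mat *v x) = plus_part x"
  "s_part (Lambda_mat *v x) = 0"
  "minus_part (Lambda_mat *v x) = - minus_part x"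
  by (simp_all add: parts_defs Lambda_mat_def vec_eq_iff forall_2
    matrix_vector_mult_def sum_6 vector_6)

lemma smult_mat_mult_vec: "(c \<cdot>\<^sub>M A) *v x = c *s (A *v x)"
  by (simp add: smult_mat_def vec_eq_iff matrix_vector_mult_def sum_distrib_left mult.assoc)

section \<open>The layer matrices in block form\<close>

text \<open>
  The four nonzero blocks of \<open>\<i> \<omega>\<^sub>2 A\<^sub>2 + \<i> \<omega>\<^sub>3 A\<^sub>3\<close> are the negatives of these two
  matrices and of their transposes, which reflects the symmetry of \<open>A\<^sub>2\<close> and \<open>A\<^sub>3\<close>.
\<close>

definition P_mat :: "real \<times> real \<Rightarrow> complex^2^2"
  where "P_mat \<omega> = (\<i> * of_real (fst \<omega>)) \<cdot>\<^sub>M E_T - (\<i> * of_real (snd \<omega>)) \<cdot>\<^sub>M J_T"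

definition Q_mat :: "real \<times> real \<Rightarrow> complex^2^2"
  where "Q_mat \<omega> = (\<i> * of_real (fst \<omega>)) \<cdot>\<^sub>M D_T - (\<i> * of_real (snd \<omega>)) \<cdot>\<^sub>M I_T"

definition B_hat :: "real \<times> real \<Rightarrow> complex \<Rightarrow> complex^6^6"
  where "B_hat \<omega> s = s \<cdot>\<^sub>M mat 1 + (\<i> * of_real (fst \<omega>)) \<cdot>\<^sub>M A2_tilde
    + (\<i> * of_real (snd \<omega>)) \<cdot>\<^sub>M A3_tilde"

lemma L_hat_vec: "L_hat a \<omega> s *v x = (a * s) *s (Lambda_mat *v x) - B_hat \<omega> s *v x"
  by (simp add: L_hat_def B_hat_def case_prod_beta matrix_vector_mult_diff_rdistrib
    matrix_vector_mult_add_rdistrib smult_mat_mult_vec vec_eq_iff algebra_simps)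

lemma K_hat_vec: "K_hat a \<omega> s *v x = (a * s) *s (Lambda_mat *v x) + B_hat \<omega> s *v x"
  by (simp add: K_hat_def B_hat_def case_prod_beta matrix_vector_mult_diff_rdistrib
    matrix_vector_mult_add_rdistrib smult_mat_mult_vec vec_eq_iff algebra_simps)

lemma minus_mat_vec: "(- A) *v (x::complex^'n) = - (A *v x)"
  by (simp add: matrix_vector_mult_def vec_eq_iff sum_negf)

lemma parts_B_hat:
  "plus_part (B_hat \<omega> s *v x) = s *s plus_part x - P_mat \<omega> *v s_part x"
  "s_part (B_hat \<omega> s *v x) = s *s s_part x - P_mat \<omega> *v plus_part x - Q_mat \<omega> *v minus_part x"
  "minus_part (B_hat \<omega> s *v x) = s *s minus_part x - transpose (Q_mat \<omega>) *v s_part x"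
proof -
  have T: "transpose (Q_mat \<omega>) = - ((\<i> * of_real (fst \<omega>)) \<cdot>\<^sub>M D_T + (\<i> * of_real (snd \<omega>)) \<cdot>\<^sub>M I_T)"
    by (simp add: Q_mat_def D_T_def I_T_def transpose_def smult_mat_def mat_def vec_eq_iff forall_2)
  show "plus_part (B_hat \<omega> s *v x) = s *s plus_part x - P_mat \<omega> *v s_part x"
    "s_part (B_hat \<omega> s *v x) = s *s s_part x - P_mat \<omega> *v plus_part x - Q_mat \<omega> *v minus_part x"
    "minus_part (B_hat \<omega> s *v x) = s *s minus_part x - transpose (Q_mat \<omega>) *v s_part x"
    unfolding T
    by (simp_all add: B_hat_def P_mat_def Q_mat_def A2_tilde_def A3_tilde_def parts_linear
        parts_block3 matrix_vector_mult_diff_rdistrib matrix_vector_mult_add_rdistrib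
        smult_mat_mult_vec minus_mat_vec vec_eq_iff algebra_simps)
qed

text \<open>
  Eliminating the middle component composes two couplings. The scalar or the multiple of
  \<open>M\<close> that results in each case is the reason why only \<open>\<bar>\<omega>\<bar>\<^sup>2\<close> and \<open>M\<close> enter the reduced system.
\<close>

lemma block_products:
  fixes x :: "complex^2" and \<omega> :: "real \<times> real"
  defines "r \<equiv> complex_of_real ((norm \<omega>)\<^sup>2)"
  shows "P_mat \<omega> *v (P_mat \<omega> *v x) = (- r / 2) *s x"
    "P_mat \<omega> *v (Q_mat \<omega> *v x) = (1 / 2) *s (M_hat \<omega> *v x)"
    "transpose (Q_mat \<omega>) *v (P_mat \<omega> *v x) = (1 / 2) *s (M_hat \<omega> *v x)"
    "transpose (Q_mat \<omega>) *v (Q_mat \<omega> *v x) = (- r / 2) *s x"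
    "M_hat \<omega> *v (M_hat \<omega> *v x) = r\<^sup>2 *s x"
proof -
  obtain y z where \<omega>: "\<omega> = (y, z)" by (cases \<omega>)
  define q where "q = complex_of_real (sqrt 2 / 2)"
  have q: "q * q = 1 / 2"
    by (simp add: q_def flip: of_real_mult)
  have q': "q * (q * t) = t / 2" for t
    by (simp add: q mult.assoc[symmetric])
  have r: "r = of_real y ^ 2 + of_real z ^ 2"
    by (simp add: r_def \<omega> norm_prod_def)
  have P: "P_mat \<omega> = (\<i> * q) \<cdot>\<^sub>M vector [vector [- of_real z, of_real y], vector [of_real y, of_real z]]"
    by (simp add: P_mat_def E_T_def J_T_def \<omega> vec_eq_iff forall_2 smult_mat_def q_def)
  have Q: "Q_mat \<omega> = (\<i> * q) \<cdot>\<^sub>M vector [vector [- of_real z, of_real y], vector [- of_real y, - of_real z]]"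
    by (simp add: Q_mat_def D_T_def I_T_def \<omega> vec_eq_iff forall_2 smult_mat_def q_def mat_def)
  note entries = P[unfolded \<omega>] Q[unfolded \<omega>] r \<omega> M_hat_def vec_eq_iff forall_2 matrix_vector_mult_def sum_2
    transpose_def smult_mat_def
  \<comment> \<open>The numeric factor stays opaque, so that it only enters through \<open>q\<^sup>2 = 1 / 2\<close>.\<close>
  note nf = algebra_simps power2_eq_square q q' add_divide_distrib diff_divide_distrib
  show "P_mat \<omega> *v (P_mat \<omega> *v x) = (- r / 2) *s x"
    by (simp add: entries del: transpose_matrix_vector) (simp add: nf)
  show "P_mat \<omega> *v (Q_mat \<omega> *v x) = (1 / 2) *s (M_hat \<omega> *v x)"
    by (simp add: entries del: transpose_matrix_vector) (simp add: nf)
  show "transpose (Q_mat \<omega>) *v (P_mat \<omega> *v x) = (1 / 2) *s (M_hat \<omega> *v x)"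
    by (simp add: entries del: transpose_matrix_vector) (simp add: nf)
  show "transpose (Q_mat \<omega>) *v (Q_mat \<omega> *v x) = (- r / 2) *s x"
    by (simp add: entries del: transpose_matrix_vector) (simp add: nf)
  show "M_hat \<omega> *v (M_hat \<omega> *v x) = r\<^sup>2 *s x"
    by (simp add: entries del: transpose_matrix_vector) (simp add: nf)
qed

section \<open>Diagonalisation of the reduced system\<close>

text \<open>
  The coefficient \<open>(s + k)\<^sup>2\<close> multiplies the minus component, rather than its inverse
  multiplying \<open>M\<close>, so that the case \<open>\<omega> = 0\<close>, in which \<open>\<kappa> = s\<close> and \<open>s - \<kappa> = 0\<close>, is included.
\<close>

definition mode :: "real \<times> real \<Rightarrow> complex \<Rightarrow> complex \<Rightarrow> complex^6 \<Rightarrow> complex^2"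
  where "mode \<omega> s k x = (s + k)\<^sup>2 *s minus_part x - M_hat \<omega> *v plus_part x"

lemma mode_linear:
  "mode \<omega> s k (x + y) = mode \<omega> s k x + mode \<omega> s k y"
  "mode \<omega> s k (x - y) = mode \<omega> s k x - mode \<omega> s k y"
  "mode \<omega> s k (c *s x) = c *s mode \<omega> s k x"
  by (simp_all add: mode_def parts_linear vec_eq_iff matrix_vector_right_distrib
      matrix_vector_mult_diff_distrib vector_scalar_commute algebra_simps)

lemma mode_Lambda_Lambda: "mode \<omega> s k (Lambda_mat *v (Lambda_mat *v x)) = mode \<omega> s k x"
  by (simp add: mode_def parts_Lambda)

text \<open>
  With the middle component eliminated, \<open>s B\<close> acts on the outer ones as
  \<open>(u, w) \<mapsto> (c u - M w / 2, c w - M u / 2)\<close> where \<open>c = s\<^sup>2 + \<bar>\<omega>\<bar>\<^sup>2 / 2\<close>. Since \<open>M\<^sup>2 = \<bar>\<omega>\<bar>\<^sup>4\<close> and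
  \<open>\<bar>\<omega>\<bar>\<^sup>2 = (k - s) (k + s)\<close>, comparing the coefficients of \<open>w\<close> and \<open>M u\<close> gives the eigenvalue.
\<close>

lemma mode_eigenform:
  assumes k: "k\<^sup>2 = s\<^sup>2 + of_real ((norm \<omega>)\<^sup>2)" and "s \<noteq> 0"
    and solved: "s_part (B_hat \<omega> s *v x) = 0"
  shows "mode \<omega> s k (Lambda_mat *v (B_hat \<omega> s *v x)) = (- k) *s mode \<omega> s k x"
proof -
  define r where "r = complex_of_real ((norm \<omega>)\<^sup>2)"
  define u v w where "u = plus_part x" and "v = s_part x" and "w = minus_part x"
  define M where "M = M_hat \<omega>"
  define U W where "U = plus_part (B_hat \<omega> s *v x)" and "W = minus_part (B_hat \<omega> s *v x)"
  have v: "s *s v = P_mat \<omega> *v u + Q_mat \<omega> *v w"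
    using solved by (simp add: parts_B_hat u_def v_def w_def algebra_simps)
  have U: "s *s U = (s\<^sup>2 + r / 2) *s u - (1 / 2) *s (M *v w)"
  proof -
    have "s *s U = s\<^sup>2 *s u - P_mat \<omega> *v (s *s v)"
      by (simp add: U_def parts_B_hat u_def v_def vector_scalar_commute vec_eq_iff
          algebra_simps power2_eq_square del: transpose_matrix_vector)
    then show ?thesis
      by (simp add: v matrix_vector_right_distrib block_products M_def r_def vec_eq_iff
          algebra_simps del: transpose_matrix_vector)
  qed
  have W: "s *s W = (s\<^sup>2 + r / 2) *s w - (1 / 2) *s (M *v u)"
  proof -
    have "s *s W = s\<^sup>2 *s w - transpose (Q_mat \<omega>) *v (s *s v)"
      by (simp add: W_def parts_B_hat w_def v_def vector_scalar_commute vec_eq_iff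
          algebra_simps power2_eq_square del: transpose_matrix_vector)
    then show ?thesis
      by (simp add: v matrix_vector_right_distrib block_products M_def r_def vec_eq_iff
          algebra_simps del: transpose_matrix_vector)
  qed
  have "s *s (M *v U) = M *v (s *s U)"
    by (simp add: vector_scalar_commute)
  also have "\<dots> = (s\<^sup>2 + r / 2) *s (M *v u) - (r\<^sup>2 / 2) *s w"
    by (simp add: U matrix_vector_mult_diff_distrib matrix_vector_right_distrib vector_scalar_commute block_products
        M_def r_def vec_eq_iff algebra_simps)
  finally have MU: "s *s (M *v U) = (s\<^sup>2 + r / 2) *s (M *v u) - (r\<^sup>2 / 2) *s w" .
  have r: "r = k\<^sup>2 - s\<^sup>2" using k by (simp add: r_def)
  have "s * (- (s + k)\<^sup>2 * W $ i - (M *v U) $ i)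
      = s * (- k * ((s + k)\<^sup>2 * w $ i - (M *v u) $ i))" for i
  proof -
    have 1: "s * W $ i = (s\<^sup>2 + r / 2) * w $ i - (M *v u) $ i / 2"
      using W by (simp add: vec_eq_iff algebra_simps)
    have 2: "s * (M *v U) $ i = (s\<^sup>2 + r / 2) * (M *v u) $ i - r\<^sup>2 / 2 * w $ i"
      using MU by (simp add: vec_eq_iff algebra_simps)
    have "s * (- (s + k)\<^sup>2 * W $ i - (M *v U) $ i)
      = - (s + k)\<^sup>2 * (s * W $ i) - s * (M *v U) $ i"
      by (simp add: algebra_simps)
    also have "\<dots> = s * (- k * ((s + k)\<^sup>2 * w $ i - (M *v u) $ i))"
      unfolding 1 2 r by (simp add: field_simps power2_eq_square)
    finally show ?thesis .
  qed
  then have "- (s + k)\<^sup>2 * W $ i - (M *v U) $ i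
      = - k * ((s + k)\<^sup>2 * w $ i - (M *v u) $ i)" for i
    using \<open>s \<noteq> 0\<close> by (metis mult_cancel_left)
  then show ?thesis
    by (simp add: mode_def parts_Lambda vec_eq_iff U_def W_def M_def u_def w_def algebra_simps)
qed

text \<open>
  The factor \<open>\<Lambda>\<close> in front turns \<open>a s \<Lambda>\<close> into the scalar \<open>a s\<close>, because \<open>\<Lambda>\<^sup>2\<close> is the identity
  on the outer components, and \<open>\<mp> B\<close> into \<open>\<mp> \<Lambda> B\<close>, of which the form is an eigenform.
\<close>

lemma mode_L_hat:
  assumes "k\<^sup>2 = s\<^sup>2 + of_real ((norm \<omega>)\<^sup>2)" and "s \<noteq> 0"
    and "s_part (B_hat \<omega> s *v x) = 0"
  shows "mode \<omega> s k (Lambda_mat *v (L_hat a \<omega> s *v x)) = (a * s + k) *s mode \<omega> s k x"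
  using mode_eigenform[OF assms]
  by (simp add: L_hat_vec matrix_vector_mult_diff_distrib vector_scalar_commute mode_linear
      mode_Lambda_Lambda vec_eq_iff algebra_simps)

lemma mode_K_hat:
  assumes "k\<^sup>2 = s\<^sup>2 + of_real ((norm \<omega>)\<^sup>2)" and "s \<noteq> 0"
    and "s_part (B_hat \<omega> s *v x) = 0"
  shows "mode \<omega> s k (Lambda_mat *v (K_hat a \<omega> s *v x)) = (a * s - k) *s mode \<omega> s k x"
  using mode_eigenform[OF assms]
  by (simp add: K_hat_vec matrix_vector_right_distrib vector_scalar_commute mode_linear
      mode_Lambda_Lambda vec_eq_iff algebra_simps)

section \<open>Position of the square root\<close>

lemma kappa_power2: "(kappa \<omega> s)\<^sup>2 = s\<^sup>2 + of_real ((norm \<omega>)\<^sup>2)"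
  by (simp add: kappa_def)

lemma Re_kappa_pos:
  assumes "Re s > 0"
  shows "Re (kappa \<omega> s) > 0"
proof -
  define k where "k = kappa \<omega> s"
  define r where "r = (norm \<omega>)\<^sup>2"
  have "r \<ge> 0" by (simp add: r_def)
  have eq: "k\<^sup>2 = s\<^sup>2 + of_real r" by (simp add: k_def r_def kappa_power2)
  have im: "Re k * Im k = Re s * Im s"
    using arg_cong[OF eq, of Im] by (simp add: power2_eq_square mult.commute)
  have re: "(Re k)\<^sup>2 - (Im k)\<^sup>2 = (Re s)\<^sup>2 - (Im s)\<^sup>2 + r"
    using arg_cong[OF eq, of Re] by (simp add: power2_eq_square)
  \<comment> \<open>A purely imaginary \<open>\<kappa>\<close> would force \<open>s\<close> to be real, and then \<open>\<kappa>\<^sup>2\<close> to be positive.\<close>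
  have "Re k \<noteq> 0"
  proof
    assume 0: "Re k = 0"
    then have "Im s = 0" using im assms by simp
    then have "- (Im k)\<^sup>2 = (Re s)\<^sup>2 + r" using re 0 by simp
    moreover have "(Re s)\<^sup>2 > 0" using assms by simp
    ultimately show False using \<open>r \<ge> 0\<close> zero_le_power2[of "Im k"] by linarith
  qed
  moreover have "Re k \<ge> 0"
    unfolding k_def kappa_def by (rule Re_csqrt)
  ultimately show ?thesis by (simp add: k_def)
qed

text \<open>
  \<open>s\<^sup>2\<close> and \<open>\<kappa>\<^sup>2\<close> differ by a real number, so \<open>Re s Im s = Re \<kappa> Im \<kappa>\<close>; as both real parts are
  positive, the imaginary parts have the same sign.
\<close>

lemma Re_s_cnj_kappa_pos:
  assumes "Re s > 0"
  shows "Re (s * cnj (kappa \<omega> s)) > 0"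
proof -
  define k where "k = kappa \<omega> s"
  have "Im (k\<^sup>2) = Im (s\<^sup>2)" by (simp add: k_def kappa_power2)
  then have im: "Re k * Im k = Re s * Im s" by (simp add: power2_eq_square mult.commute)
  have k: "Re k > 0" using Re_kappa_pos[OF assms] by (simp add: k_def)
  have "Re k * (Im s * Im k) = Re s * (Im s)\<^sup>2"
    using im by (simp add: power2_eq_square algebra_simps)
  then have "Re k * (Im s * Im k) \<ge> 0" using assms by simp
  then have "Im s * Im k \<ge> 0" using k by (simp add: zero_le_mult_iff)
  moreover have "Re s * Re k > 0" using assms k by simp
  ultimately show ?thesis by (simp add: k_def)
qed

lemma cmod_diff_less_cmod_add:
  assumes "Re (z * cnj k) > 0"
  shows "cmod (z - k) < cmod (z + k)"
proof -
  have "(cmod (z - k))\<^sup>2 < (cmod (z + k))\<^sup>2"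
    unfolding cmod_power2 using assms by (simp add: power2_eq_square algebra_simps)
  then show ?thesis by (rule power_less_imp_less_base) simp
qed

section \<open>Propagation through the layers\<close>

text \<open>
  The two recursions are kept apart because only the \<open>p j\<close> are known to be nonzero: each lemma
  runs in the direction that divides by \<open>p j\<close>.
\<close>

lemma telescope_forward:
  fixes v :: "nat \<Rightarrow> complex^'n"
  assumes "\<And>j. j \<in> {1..n} \<Longrightarrow> p j \<noteq> 0 \<and> p j *s v j = m j *s v (Suc j)"
  shows "v 1 = (\<Prod>j = 1..n. m j / p j) *s v (Suc n)"
  using assms
proof (induction n)
  case (Suc n)
  have "p (Suc n) \<noteq> 0" and step: "p (Suc n) *s v (Suc n) = m (Suc n) *s v (Suc (Suc n))"
    using Suc.prems[of "Suc n"] by auto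
  then have "v (Suc n) = (m (Suc n) / p (Suc n)) *s v (Suc (Suc n))"
    by (simp add: vec_eq_iff field_simps)
  moreover have "v 1 = (\<Prod>j = 1..n. m j / p j) *s v (Suc n)"
    using Suc.prems by (intro Suc.IH) auto
  ultimately show ?case by (simp add: prod.cl_ivl_Suc)
qed simp

lemma telescope_backward:
  fixes v :: "nat \<Rightarrow> complex^'n"
  assumes "\<And>j. j \<in> {1..n} \<Longrightarrow> p j \<noteq> 0 \<and> m j *s v j = p j *s v (Suc j)"
  shows "v (Suc n) = (\<Prod>j = 1..n. m j / p j) *s v 1"
  using assms
proof (induction n)
  case (Suc n)
  have "p (Suc n) \<noteq> 0" and step: "m (Suc n) *s v (Suc n) = p (Suc n) *s v (Suc (Suc n))"
    using Suc.prems[of "Suc n"] by auto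
  then have "v (Suc (Suc n)) = (m (Suc n) / p (Suc n)) *s v (Suc n)"
    by (simp add: vec_eq_iff field_simps)
  moreover have "v (Suc n) = (\<Prod>j = 1..n. m j / p j) *s v 1"
    using Suc.prems by (intro Suc.IH) auto
  ultimately show ?case by (simp add: prod.cl_ivl_Suc mult.commute)
qed simp

section \<open>The reflection relation\<close>

theorem lemma4p1:
  fixes J :: nat and \<omega>\<^sub>2 \<omega>\<^sub>3 :: real and s :: complex
    and a :: "nat \<Rightarrow> real" and \<rho> :: "nat \<Rightarrow> complex^6"
  assumes "J \<ge> 1"
    and "((\<omega>\<^sub>2, \<omega>\<^sub>3), s) \<in> U_set"
    and "0 < a 0" and "a 0 \<le> 1"
    and "\<forall>j\<in>{1..J}. 0 < a j \<and> a j < 1"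
    and "(s \<cdot>\<^sub>M Lambda_mat) *v \<rho> 1 - L_hat (a 0) (\<omega>\<^sub>2, \<omega>\<^sub>3) s *v \<rho> 0 = 0"
    and "\<forall>j\<in>{1..J}. L_hat (a j) (\<omega>\<^sub>2, \<omega>\<^sub>3) s *v \<rho> j
                     - K_hat (a j) (\<omega>\<^sub>2, \<omega>\<^sub>3) s *v \<rho> (j + 1) = 0"
    and "minus_part (\<rho> (J + 1)) = 0"
    and "s_part (\<rho> 1) =
      (1 / s) *s (((\<i> * of_real \<omega>\<^sub>2) \<cdot>\<^sub>M E_T - (\<i> * of_real \<omega>\<^sub>3) \<cdot>\<^sub>M J_T) *v plus_part (\<rho> 1))
      + (1 / s) *s (((\<i> * of_real \<omega>\<^sub>2) \<cdot>\<^sub>M D_T - (\<i> * of_real \<omega>\<^sub>3) \<cdot>\<^sub>M I_T) *v minus_part (\<rho> 1))"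
  shows "(\<forall>j\<in>{0..J}. gamma_plus a (\<omega>\<^sub>2, \<omega>\<^sub>3) s j \<noteq> 0)
    \<and> 1 - gamma_total a (\<omega>\<^sub>2, \<omega>\<^sub>3) s J \<noteq> 0
    \<and> beta a (\<omega>\<^sub>2, \<omega>\<^sub>3) s J \<noteq> 0
    \<and> minus_part (\<rho> 0) = S_Gamma a (\<omega>\<^sub>2, \<omega>\<^sub>3) s J *v plus_part (\<rho> 0)"
proof -
  define \<omega> where "\<omega> = (\<omega>\<^sub>2, \<omega>\<^sub>3)"
  define \<kappa> where "\<kappa> = kappa \<omega> s"
  define p where "p = gamma_plus a \<omega> s"
  define m where "m = gamma_minus a \<omega> s"
  define \<gamma> where "\<gamma> = gamma_total a \<omega> s J"
  \<comment> \<open>The factor for one passage: outwards for \<open>- \<kappa>\<close>, inwards for \<open>\<kappa>\<close>.\<close>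
  define R where "R = (\<Prod>j = 1..J. m j / p j)"
  have p: "p j = a j * s + \<kappa>" and m: "m j = a j * s - \<kappa>" for j
    by (simp_all add: p_def m_def gamma_plus_def gamma_minus_def \<kappa>_def)
  have s: "Re s > 0" "s \<noteq> 0" using assms(2) by (auto simp: U_set_def)
  have a: "a j > 0" if "j \<in> {0..J}" for j
    using assms(3,5) that by (cases "j = 0") auto

  have m_less_p: "cmod (m j) < cmod (p j)" if "j \<in> {0..J}" for j
  proof -
    have "Re (of_real (a j) * s * cnj \<kappa>) = a j * Re (s * cnj \<kappa>)"
      by (simp add: algebra_simps)
    then have "Re (of_real (a j) * s * cnj \<kappa>) > 0"
      using a[OF that] Re_s_cnj_kappa_pos[OF s(1), of \<omega>] by (simp add: \<kappa>_def)
    then show ?thesis unfolding p m by (rule cmod_diff_less_cmod_add)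
  qed
  have p_nz: "p j \<noteq> 0" if "j \<in> {0..J}" for j
    using m_less_p[OF that] by auto
  have quot: "cmod (m j / p j) < 1" if "j \<in> {0..J}" for j
    using m_less_p[OF that] p_nz[OF that] by (simp add: norm_divide)

  have \<gamma>: "\<gamma> = m 0 / p 0 * R\<^sup>2"
    by (simp add: \<gamma>_def gamma_total_def p_def m_def R_def prod_power_distrib)
  have "cmod R \<le> 1"
    unfolding R_def prod_norm[symmetric] using quot by (intro prod_le_1) (auto intro: less_imp_le)
  then have "cmod R ^ 2 \<le> 1" by (simp add: power_le_one)
  then have "cmod (m 0 / p 0) * cmod R ^ 2 \<le> cmod (m 0 / p 0)"
    by (intro mult_right_le_one_le) auto
  then have \<gamma>_less: "cmod \<gamma> < 1"
    using quot[of 0] unfolding \<gamma> norm_mult norm_power by (simp del: norm_divide)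
  then have \<gamma>_ne: "1 - \<gamma> \<noteq> 0" by auto

  define d where "d = (\<kappa> + s)\<^sup>2 - (\<kappa> - s)\<^sup>2 * \<gamma>"
  have "cmod (s - \<kappa>) < cmod (s + \<kappa>)"
    using cmod_diff_less_cmod_add[OF Re_s_cnj_kappa_pos[OF s(1)]] by (simp add: \<kappa>_def)
  then have "cmod (\<kappa> - s) ^ 2 < cmod (\<kappa> + s) ^ 2"
    by (intro power_strict_mono) (simp_all add: norm_minus_commute add.commute)
  moreover have "cmod (\<kappa> - s) ^ 2 * cmod \<gamma> \<le> cmod (\<kappa> - s) ^ 2"
    using \<gamma>_less by (intro mult_right_le_one_le) auto
  ultimately have "cmod ((\<kappa> - s)\<^sup>2 * \<gamma>) < cmod ((\<kappa> + s)\<^sup>2)"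
    by (simp add: norm_mult norm_power)
  then have d_ne: "d \<noteq> 0" by (auto simp: d_def)
  have \<beta>: "beta a \<omega> s J = d / (1 - \<gamma>)"
    by (simp add: beta_def d_def \<kappa>_def \<gamma>_def)

  have step: "L_hat (a j) \<omega> s *v \<rho> j = K_hat (a j) \<omega> s *v \<rho> (Suc j)" if "j \<in> {1..J}" for j
    using assms(7) that by (simp add: \<omega>_def)
  have first: "s *s (Lambda_mat *v \<rho> 1) = L_hat (a 0) \<omega> s *v \<rho> 0"
    using assms(6) by (simp add: \<omega>_def smult_mat_mult_vec)

  have solved0: "s_part (B_hat \<omega> s *v \<rho> 0) = 0"
    using arg_cong[OF first, of s_part] by (simp add: L_hat_vec parts_linear parts_Lambda)
  have solved: "s_part (B_hat \<omega> s *v \<rho> (Suc j)) = 0" if "j \<le> J" for j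
    using that
  proof (induction j)
    case 0
    have "s *s s_part (\<rho> 1) = P_mat \<omega> *v plus_part (\<rho> 1) + Q_mat \<omega> *v minus_part (\<rho> 1)"
      using s(2) unfolding assms(9) by (simp add: P_mat_def Q_mat_def \<omega>_def vec_eq_iff field_simps)
    then show ?case by (simp add: parts_B_hat)
  next
    case (Suc j)
    then have "s_part (B_hat \<omega> s *v \<rho> (Suc j)) = 0" by simp
    with arg_cong[OF step, of "Suc j" s_part] Suc.prems
    show ?case by (simp add: L_hat_vec K_hat_vec parts_linear parts_Lambda)
  qed

  have mode_first: "s *s mode \<omega> s k (\<rho> 1) = (a 0 * s + k) *s mode \<omega> s k (\<rho> 0)"
    if "k\<^sup>2 = s\<^sup>2 + of_real ((norm \<omega>)\<^sup>2)" for k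
    using mode_L_hat[OF that s(2) solved0, of "a 0"]
    by (simp add: first[symmetric] vector_scalar_commute mode_linear mode_Lambda_Lambda)
  have mode_step: "(a j * s + k) *s mode \<omega> s k (\<rho> j) = (a j * s - k) *s mode \<omega> s k (\<rho> (Suc j))"
    if "k\<^sup>2 = s\<^sup>2 + of_real ((norm \<omega>)\<^sup>2)" and j: "j \<in> {1..J}" for k j
  proof -
    have "s_part (B_hat \<omega> s *v \<rho> j) = 0" using solved[of "j - 1"] j by auto
    from mode_L_hat[OF that(1) s(2) this, of "a j"] step[OF j]
      mode_K_hat[OF that(1) s(2) solved[of j], of "a j"] j
    show ?thesis by simp
  qed
  have \<kappa>2: "\<kappa>\<^sup>2 = s\<^sup>2 + of_real ((norm \<omega>)\<^sup>2)" "(- \<kappa>)\<^sup>2 = s\<^sup>2 + of_real ((norm \<omega>)\<^sup>2)"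
    by (simp_all add: \<kappa>_def kappa_power2)

  \<comment> \<open>The round trip through the layers, with \<open>\<rho>\<^sub>- = 0\<close> at its turning point.\<close>
  have "mode \<omega> s \<kappa> (\<rho> 1) = R *s mode \<omega> s \<kappa> (\<rho> (Suc J))"
    unfolding R_def using p_nz mode_step[OF \<kappa>2(1)]
    by (intro telescope_forward[where v = "\<lambda>j. mode \<omega> s \<kappa> (\<rho> j)"]) (auto simp: p m)
  also have "mode \<omega> s \<kappa> (\<rho> (Suc J)) = mode \<omega> s (- \<kappa>) (\<rho> (Suc J))"
    using assms(8) by (simp add: mode_def)
  also have "mode \<omega> s (- \<kappa>) (\<rho> (Suc J)) = R *s mode \<omega> s (- \<kappa>) (\<rho> 1)"
    unfolding R_def using p_nz mode_step[OF \<kappa>2(2)]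
    by (intro telescope_backward[where v = "\<lambda>j. mode \<omega> s (- \<kappa>) (\<rho> j)"]) (auto simp: p m)
  finally have at1: "mode \<omega> s \<kappa> (\<rho> 1) = R\<^sup>2 *s mode \<omega> s (- \<kappa>) (\<rho> 1)"
    by (simp add: power2_eq_square)
  have inner: "s *s mode \<omega> s (- \<kappa>) (\<rho> 1) = m 0 *s mode \<omega> s (- \<kappa>) (\<rho> 0)"
    using mode_first[OF \<kappa>2(2)] by (simp add: m)
  have "p 0 *s mode \<omega> s \<kappa> (\<rho> 0) = s *s mode \<omega> s \<kappa> (\<rho> 1)"
    using mode_first[OF \<kappa>2(1)] by (simp add: p)
  also have "\<dots> = R\<^sup>2 *s (s *s mode \<omega> s (- \<kappa>) (\<rho> 1))"
    by (simp only: at1 vector_smult_assoc mult.commute)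
  also have "\<dots> = (R\<^sup>2 * m 0) *s mode \<omega> s (- \<kappa>) (\<rho> 0)"
    by (simp only: inner vector_smult_assoc)
  finally have "mode \<omega> s \<kappa> (\<rho> 0) = \<gamma> *s mode \<omega> s (- \<kappa>) (\<rho> 0)"
    using p_nz[of 0] by (simp add: \<gamma> vec_eq_iff field_simps)
  then have "d *s minus_part (\<rho> 0) = (1 - \<gamma>) *s (M_hat \<omega> *v plus_part (\<rho> 0))"
    by (simp add: mode_def d_def vec_eq_iff power2_eq_square algebra_simps)
  then have "minus_part (\<rho> 0) = S_Gamma a \<omega> s J *v plus_part (\<rho> 0)"
    using d_ne by (simp add: S_Gamma_def smult_mat_mult_vec \<beta> vec_eq_iff field_simps)
  then show ?thesis
    using p_nz \<gamma>_ne d_ne \<beta> unfolding p_def \<gamma>_def \<omega>_def by auto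
qed

end
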